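(* Let $\mathbb{X}\subset\mathbb{R}^n$, let $Y$ be a nonempty subset of a Banach space $\mathbb{Y}$, let $T\subset\mathbb{R}^l$ be nonempty and convex, and let $\psi_i:\mathbb{X}\times Y\times T\to\mathbb{R}$, $i=1,\dots,m$, be continuous. Put $\psi=(\psi_1,\dots,\psi_m)^T$ and $X(y,t):=\{x\in\mathbb{X}:\psi_i(x,y,t)\le0,\ i=1,\dots,m\}$. Assume: (a) $\psi_i(x,y,t)$ is convex in $x$ for every fixed $(y,t)$, $i=1,\dots,m$; (b) there is a constant $\alpha>0$ such that for every $(y,t)\in Y\times T$ there exists $\bar x(y,t)\in X(y,t)$ with $\psi_i(\bar x(y,t),y,t)\le-\alpha$ for $i=1,\dots,m$; (c) there is a constant $A>0$ such that $\mathrm{diam}(X(y,t))\le A$ for all $(y,t)\in Y\times T$; (d) there are constants $\kappa_\psi>0$ and $q_\psi\in(0,1]$ such that $\|\psi(x,y,t')-\psi(x,y,t'')\|\le\kappa_\psi\|t'-t''\|^{q_\psi}$ for all $t',t''\in T$ and all $(x,y)\in\mathbb{X}\times Y$. Then the following hold. (i) For any fixed $(y,t)\in Y\times T$ and $x\in\mathbb{R}^n$, let $\gamma:=\|(\psi(x,y,t))_+\|$ and $\hat x(y,t):=\left(1-\frac{\gamma}{\gamma+\alpha}\right)x+\frac{\gamma}{\gamma+\alpha}\bar x(y,t)$. Then $\hat x(y,t)\in X(y,t)$, $$\|x-\hat x(y,t)\|\le\frac{\|x-\bar x(y,t)\|}{\alpha}\|(\psi(x,y,t))_+\|,$$ and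 $$d(x,X(y,t))\le\frac{\mathrm{diam}(X(y,t))}{\alpha}\|(\psi(x,y,t))_+\|.$$ (ii) The feasible set-valued mapping $X(y,t)$ is uniformly continuous in $t\in T$: for all $y\in Y$, $$\mathbb{H}(X(y,t'),X(y,t''))\le\frac{A\kappa_\psi}{\alpha}\|t'-t''\|^{q_\psi},\quad\forall t',t''\in T.$$ (iii) For any fixed $y\in Y$ there exists a continuous mapping $\upsilon:T\to\mathbb{X}$ such that for $i=1,\dots,m$, $\psi_i(\upsilon(t),y,t)\le-\frac{\alpha}{2}$ for all $t\in T$.
   Context: $X(y,t)$ is the feasible set of a parametric minimization problem over $x\in\mathbb{X}$ with constraints $\psi_i(x,y,t)\le0$, $i=1,\dots,m$, and parameters $(y,t)\in Y\times T$. $\|\cdot\|$ is the Euclidean norm on finite-dimensional spaces; $(z)_+:=\max(0,z)$ componentwise; $d(x,S)=\inf_{s\in S}\|x-s\|$; $\mathrm{diam}(S)=\sup_{s,s'\in S}\|s-s'\|$; $\mathbb{H}(S_1,S_2)=\max\{\sup_{s\in S_1}d(s,S_2),\sup_{s\in S_2}d(s,S_1)\}$ is the Hausdorff distance.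
   Formalization: In (i), x ranges over 𝕏 rather than all of ℝⁿ, since ψ(x,y,t) is defined only for x in 𝕏 and x̂ need not lie in 𝕏 otherwise; the set 𝕏 is taken to be convex, as the convexity of ψ_i in x presupposes. *)

theory Defs
  imports "HOL-Analysis.Analysis"
begin

definition constraint_vec ::
  "('m::finite \<Rightarrow> real ^ 'n \<Rightarrow> 'b \<Rightarrow> real ^ 'l \<Rightarrow> real) \<Rightarrow> real ^ 'n \<Rightarrow> 'b \<Rightarrow> real ^ 'l \<Rightarrow> real ^ 'm"
  where "constraint_vec \<psi> x y t = (\<chi> i. \<psi> i x y t)"

definition feasible_set ::
  "(real ^ 'n) set \<Rightarrow> ('m \<Rightarrow> real ^ 'n \<Rightarrow> 'b \<Rightarrow> real ^ 'l \<Rightarrow> real) \<Rightarrow> 'b \<Rightarrow> real ^ 'l \<Rightarrow> (real ^ 'n) set"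
  where "feasible_set D \<psi> y t = {x \<in> D. \<forall>i. \<psi> i x y t \<le> 0}"

definition vec_pos_part :: "real ^ 'm \<Rightarrow> real ^ 'm"
  where "vec_pos_part z = (\<chi> i. max 0 (z $ i))"

(* The suprema are taken in the reals and infdist to the empty set is 0, so this is the usual
   Hausdorff distance only for nonempty bounded sets. *)
definition hausdorff_distance :: "'a::metric_space set \<Rightarrow> 'a set \<Rightarrow> real"
  where "hausdorff_distance S1 S2 = max (SUP s\<in>S1. infdist s S2) (SUP s\<in>S2. infdist s S1)"

definition hausdorff_uniformly_continuous_on ::
  "'c::metric_space set \<Rightarrow> ('c \<Rightarrow> 'a::metric_space set) \<Rightarrow> bool"
  where "hausdorff_uniformly_continuous_on T F \<longleftrightarrow>
    (\<forall>e>0. \<exists>d>0. \<forall>t\<in>T. \<forall>t'\<in>T. dist t t' < d \<longrightarrow> hausdorff_distance (F t) (F t') < e)"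

end

theory Submission
  imports Defs
begin

text \<open>A Slater point with margin \<open>\<alpha>\<close> lets one repair a constraint violation \<open>\<gamma>\<close> by moving the fraction
  \<open>\<gamma> / (\<gamma> + \<alpha>)\<close> of the way towards it, which convexity turns into a linear error bound. Applied to a
  point feasible at \<open>t'\<close>, whose violation at \<open>t''\<close> is at most \<open>\<kappa> \<parallel>t' - t''\<parallel>\<^sup>q\<close>, it gives the Hausdorff
  estimate. For the selection, the Slater point at \<open>t\<close> retains the margin \<open>\<alpha> / 2\<close> near \<open>t\<close>; since the
  sets of points with that margin are convex, these local choices are glued by a partition of unity.\<close>

text \<open>Turns a Hoelder bound into an epsilon-delta statement. It serves both the uniform
  continuity of the feasible sets and the neighbourhoods used for the selection.\<close>

lemma powr_bound_eventually_small:
  fixes C e q :: real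
  assumes "0 \<le> C" "0 < e" "0 < q"
  obtains \<delta> where "0 < \<delta>" "\<And>r. 0 \<le> r \<Longrightarrow> r < \<delta> \<Longrightarrow> C * r powr q < e"
proof
  \<comment> \<open>The solution of \<open>(C + 1) * ?\<delta> powr q = e\<close>; the
    \<open>+ 1\<close> keeps the quotient positive when \<open>C = 0\<close>.\<close>
  let ?\<delta> = "(e / (C + 1)) powr (1 / q)"
  show "0 < ?\<delta>"
    using assms by simp
  fix r assume r: "0 \<le> r" "r < ?\<delta>"
  have "r powr q < ?\<delta> powr q"
    using r assms by (intro powr_less_mono2) auto
  also have "\<dots> = e / (C + 1)"
    using assms by (simp add: powr_powr)
  finally have "(C + 1) * r powr q < e"
    using assms by (simp add: field_simps)
  then show "C * r powr q < e"
    unfolding distrib_right using powr_ge_zero[of r q] by linarith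
qed

text \<open>The neighbourhoods on which one point serves form an open cover; a partition of unity on
  a locally finite refinement averages these points. At each \<open>s\<close> only points of
  \<open>G s\<close> carry positive weight, so convexity keeps the average in
  \<open>G s\<close>.\<close>

lemma continuous_selection_of_locally_constant:
  fixes S :: "'a::{metric_space,second_countable_topology} set"
    and G :: "'a \<Rightarrow> 'b::real_normed_vector set"
  assumes conv: "\<And>s. s \<in> S \<Longrightarrow> convex (G s)"
    and loc: "\<And>s. s \<in> S \<Longrightarrow> \<exists>U x. open U \<and> s \<in> U \<and> (\<forall>s' \<in> S \<inter> U. x \<in> G s')"
  obtains f where "continuous_on S f" "\<And>s. s \<in> S \<Longrightarrow> f s \<in> G s"
proof -
  let ?C = "{U. open U \<and> (\<exists>x. \<forall>s \<in> S \<inter> U. x \<in> G s)}"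
  have "S \<subseteq> \<Union>?C"
    using loc by blast
  then obtain \<C> where cover: "S \<subseteq> \<Union>\<C>"
    and refine: "\<And>U. U \<in> \<C> \<Longrightarrow> open U \<and> (\<exists>V. V \<in> ?C \<and> U \<subseteq> V)"
    and lf: "\<And>s. s \<in> S \<Longrightarrow> \<exists>V. open V \<and> s \<in> V \<and> finite {U \<in> \<C>. U \<inter> V \<noteq> {}}"
    by (rule paracompact) auto
  \<comment> \<open>A member of the refinement inherits the common point of a cover set containing
    it.\<close>
  have "\<exists>x. \<forall>s \<in> S \<inter> U. x \<in> G s" if "U \<in> \<C>" for U
    using refine[OF that] by blast
  then obtain p where p: "\<And>U s. U \<in> \<C> \<Longrightarrow> s \<in> S \<Longrightarrow> s \<in> U \<Longrightarrow> p U \<in> G s"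
    by (metis IntI)
  obtain F :: "'a set \<Rightarrow> 'a \<Rightarrow> real"
    where F: "\<And>U. U \<in> \<C> \<Longrightarrow> continuous_on S (F U) \<and> (\<forall>s \<in> S. 0 \<le> F U s)"
      and F0: "\<And>s U. \<lbrakk>U \<in> \<C>; s \<in> S; s \<notin> U\<rbrakk> \<Longrightarrow> F U s = 0"
      and F1: "\<And>s. s \<in> S \<Longrightarrow> supp_sum (\<lambda>U. F U s) \<C> = 1"
    using refine by (rule_tac subordinate_partition_of_unity[OF cover _ lf]) auto
  define f where "f s = supp_sum (\<lambda>U. F U s *\<^sub>R p U) \<C>" for s
  show thesis
  proof
    show "f s \<in> G s" if "s \<in> S" for s
      unfolding f_def using that F F0 p
      by (intro convex_supp_sum conv F1) blast+
    have "continuous (at s within S) f" if s: "s \<in> S" for s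
    proof -
      obtain V where V: "open V" "s \<in> V" and fin: "finite {U \<in> \<C>. U \<inter> V \<noteq> {}}"
        using lf[OF s] by blast
      have "openin (top_of_set S) (S \<inter> V)"
        using V by blast
      \<comment> \<open>The index set of the support sum varies with the point. On \<open>V\<close>
        it may be enlarged to the fixed finite set of members meeting \<open>V\<close>, the added
        terms having weight zero, so that continuity is that of a finite sum.\<close>
      moreover have "(\<Sum>U | U \<in> \<C> \<and> U \<inter> V \<noteq> {}. F U s' *\<^sub>R p U) = f s'" if "s' \<in> S \<inter> V" for s'
        unfolding f_def supp_sum_def using that F0
        by (intro sum.mono_neutral_right[OF fin]) (auto simp: support_on_def)
      moreover have "continuous (at s within S) (\<lambda>s'. \<Sum>U | U \<in> \<C> \<and> U \<inter> V \<noteq> {}. F U s' *\<^sub>R p U)"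
        using F s by (intro continuous_intros) (auto simp: continuous_on_eq_continuous_within)
      ultimately show ?thesis
        using s V by (auto intro: continuous_transform_within_openin)
    qed
    then show "continuous_on S f"
      by (simp add: continuous_on_eq_continuous_within)
  qed
qed

text \<open>The weight is chosen for balance: the violation \<gamma>, scaled by
  \<open>\<alpha> / (\<gamma> + \<alpha>)\<close>, exactly cancels the margin \<alpha>, scaled by
  \<open>\<gamma> / (\<gamma> + \<alpha>)\<close>.\<close>

lemma slater_segment_feasible:
  fixes \<alpha> \<gamma> :: real
  assumes f: "convex_on D f" and x: "x \<in> D" "f x \<le> \<gamma>" and z: "z \<in> D" "f z \<le> - \<alpha>"
    and pos: "0 \<le> \<gamma>" "0 < \<alpha>"
  defines "w \<equiv> (1 - \<gamma> / (\<gamma> + \<alpha>)) *\<^sub>R x + (\<gamma> / (\<gamma> + \<alpha>)) *\<^sub>R z"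
  shows "w \<in> D" "f w \<le> 0"
proof -
  let ?l = "\<gamma> / (\<gamma> + \<alpha>)"
  have l: "0 \<le> ?l" "?l \<le> 1"
    using pos by auto
  show "w \<in> D"
    unfolding w_def using convex_on_imp_convex[OF f] x z l by (intro convexD_alt) auto
  have "f w \<le> (1 - ?l) * f x + ?l * f z"
    unfolding w_def using x z l by (intro convex_onD[OF f]) auto
  also have "\<dots> \<le> (1 - ?l) * \<gamma> + ?l * (- \<alpha>)"
    using x z l by (intro add_mono mult_left_mono) auto
  also have "\<dots> = 0"
    using pos by (simp add: field_simps)
  finally show "f w \<le> 0" .
qed

text \<open>The step length is measured in two ways. The first uses the whole segment from
  \<open>x\<close> to \<open>z\<close>. The second uses only the part from \<open>w\<close> to
  \<open>z\<close>, both of whose ends are feasible in the application, so a diameter can bound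
  it.\<close>

lemma slater_segment_distance:
  fixes x z :: "'a::real_normed_vector" and \<alpha> \<gamma> :: real
  assumes pos: "0 \<le> \<gamma>" "0 < \<alpha>"
  defines "w \<equiv> (1 - \<gamma> / (\<gamma> + \<alpha>)) *\<^sub>R x + (\<gamma> / (\<gamma> + \<alpha>)) *\<^sub>R z"
  shows "norm (x - w) \<le> norm (x - z) / \<alpha> * \<gamma>"
    and "norm (x - w) = norm (w - z) / \<alpha> * \<gamma>"
proof -
  have "x - w = (\<gamma> / (\<gamma> + \<alpha>)) *\<^sub>R (x - z)"
    by (simp add: w_def algebra_simps)
  then have xw: "norm (x - w) = \<gamma> / (\<gamma> + \<alpha>) * norm (x - z)"
    using pos by simp
  have "w - z = (1 - \<gamma> / (\<gamma> + \<alpha>)) *\<^sub>R (x - z)"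
    by (simp add: w_def algebra_simps)
  moreover have "1 - \<gamma> / (\<gamma> + \<alpha>) = \<alpha> / (\<gamma> + \<alpha>)"
    using pos by (simp add: field_simps)
  ultimately have wz: "norm (w - z) = \<alpha> / (\<gamma> + \<alpha>) * norm (x - z)"
    using pos by simp
  have "\<gamma> / (\<gamma> + \<alpha>) \<le> \<gamma> / \<alpha>"
    using pos by (intro divide_left_mono) auto
  then show "norm (x - w) \<le> norm (x - z) / \<alpha> * \<gamma>"
    using mult_right_mono[of _ _ "norm (x - z)"] by (fastforce simp: xw mult.commute)
  show "norm (x - w) = norm (w - z) / \<alpha> * \<gamma>"
    using pos by (simp add: xw wz)
qed

lemma le_norm_vec_pos_part: "z $ i \<le> norm (vec_pos_part z)"
proof -
  have "z $ i \<le> vec_pos_part z $ i"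
    by (simp add: vec_pos_part_def)
  then show ?thesis
    using component_le_norm_cart[of "vec_pos_part z" i] by linarith
qed

text \<open>With \<open>w\<close> the constraint values at a parameter where the point is feasible,
  this bounds the violation at another parameter by the variation of the constraints.\<close>

lemma norm_vec_pos_part_le_diff:
  assumes "\<And>i. w $ i \<le> 0"
  shows "norm (vec_pos_part z) \<le> norm (z - w)"
proof (rule norm_le_componentwise_cart)
  fix i show "norm (vec_pos_part z $ i) \<le> norm ((z - w) $ i)"
    using assms[of i] by (simp add: vec_pos_part_def)
qed

lemma infdist_le_slater_violation:
  fixes S :: "'a::real_normed_vector set" and z :: "real ^ 'm" and \<alpha> :: real
  assumes S: "bounded S" "xb \<in> S"
    and \<gamma>: "\<gamma> = norm (vec_pos_part z)" and pos: "0 < \<alpha>"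
    and w: "(1 - \<gamma> / (\<gamma> + \<alpha>)) *\<^sub>R x + (\<gamma> / (\<gamma> + \<alpha>)) *\<^sub>R xb \<in> S" (is "?w \<in> S")
  shows "infdist x S \<le> diameter S / \<alpha> * \<gamma>"
proof -
  have "0 \<le> \<gamma>"
    by (simp add: \<gamma>)
  have "infdist x S \<le> norm (x - ?w)"
    using infdist_le[OF w, of x] by (simp add: dist_norm)
  \<comment> \<open>The bound through \<open>norm (x - xb)\<close> would not do here:
    \<open>x\<close> may lie outside \<open>S\<close>, so that norm can exceed the diameter.\<close>
  also have "\<dots> = norm (?w - xb) / \<alpha> * \<gamma>"
    by (rule slater_segment_distance(2)) fact+
  also have "\<dots> \<le> diameter S / \<alpha> * \<gamma>"
    using diameter_bounded_bound[OF S(1) w S(2)] pos \<open>0 \<le> \<gamma>\<close>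
    by (intro mult_right_mono divide_right_mono) (auto simp: dist_norm)
  finally show ?thesis .
qed

text \<open>Nonemptiness lets a bound on the elements pass to the real-valued suprema.\<close>

lemma hausdorff_distance_leI:
  assumes "S \<noteq> {}" "S' \<noteq> {}"
    and "\<And>s. s \<in> S \<Longrightarrow> infdist s S' \<le> r" "\<And>s. s \<in> S' \<Longrightarrow> infdist s S \<le> r"
  shows "hausdorff_distance S S' \<le> r"
  unfolding hausdorff_distance_def using assms by (auto intro!: cSUP_least)

lemma hausdorff_uniformly_continuous_on_if_hoelder:
  assumes "0 \<le> C" "0 < q"
    and le: "\<And>t t'. t \<in> T \<Longrightarrow> t' \<in> T \<Longrightarrow> hausdorff_distance (F t) (F t') \<le> C * dist t t' powr q"
  shows "hausdorff_uniformly_continuous_on T F"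
  unfolding hausdorff_uniformly_continuous_on_def
proof (intro allI impI)
  fix e :: real assume "0 < e"
  then obtain \<delta> where "0 < \<delta>" and \<delta>: "\<And>r. 0 \<le> r \<Longrightarrow> r < \<delta> \<Longrightarrow> C * r powr q < e"
    using powr_bound_eventually_small assms by metis
  then show "\<exists>\<delta>>0. \<forall>t\<in>T. \<forall>t'\<in>T. dist t t' < \<delta> \<longrightarrow> hausdorff_distance (F t) (F t') < e"
    by (meson le le_less_trans zero_le_dist)
qed

lemma convex_sublevel:
  assumes "\<And>i. convex_on D (f i)" and "convex D"
  shows "convex {x \<in> D. \<forall>i. f i x \<le> (c::real)}"
  unfolding convex_alt
proof (intro ballI allI impI, elim conjE)
  fix x y and u :: real
  assume x: "x \<in> {x \<in> D. \<forall>i. f i x \<le> c}" and y: "y \<in> {x \<in> D. \<forall>i. f i x \<le> c}" and u: "0 \<le> u" "u \<le> 1"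
  have "f i ((1 - u) *\<^sub>R x + u *\<^sub>R y) \<le> c" for i
  proof -
    have "f i ((1 - u) *\<^sub>R x + u *\<^sub>R y) \<le> (1 - u) * f i x + u * f i y"
      using x y u by (intro convex_onD[OF assms(1)]) auto
    also have "\<dots> \<le> c"
      using x y u by (intro convex_bound_le) auto
    finally show ?thesis .
  qed
  then show "(1 - u) *\<^sub>R x + u *\<^sub>R y \<in> {x \<in> D. \<forall>i. f i x \<le> c}"
    using x y u convexD_alt[OF assms(2)] by auto
qed

theorem lemma3p1:
  fixes D :: "(real ^ 'n) set"
    and Y :: "'b::banach set"
    and T :: "(real ^ 'l) set"
    and \<psi> :: "'m::finite \<Rightarrow> real ^ 'n \<Rightarrow> 'b \<Rightarrow> real ^ 'l \<Rightarrow> real"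
    and xbar :: "'b \<Rightarrow> real ^ 'l \<Rightarrow> real ^ 'n"
    and \<alpha> A \<kappa> q :: real
  defines "X \<equiv> feasible_set D \<psi>"
    and "\<Psi> \<equiv> constraint_vec \<psi>"
  assumes Y_nonempty: "Y \<noteq> {}"
    and T_nonempty: "T \<noteq> {}"
    and T_convex: "convex T"
    and cont: "\<And>i. continuous_on (D \<times> Y \<times> T) (\<lambda>(x, y, t). \<psi> i x y t)"
    and a: "\<And>i y t. y \<in> Y \<Longrightarrow> t \<in> T \<Longrightarrow> convex_on D (\<lambda>x. \<psi> i x y t)"
    and alpha_pos: "\<alpha> > 0"
    and b: "\<And>y t. y \<in> Y \<Longrightarrow> t \<in> T \<Longrightarrow>
              xbar y t \<in> X y t \<and> (\<forall>i. \<psi> i (xbar y t) y t \<le> - \<alpha>)"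
    and A_pos: "A > 0"
    and c: "\<And>y t. y \<in> Y \<Longrightarrow> t \<in> T \<Longrightarrow> bounded (X y t) \<and> diameter (X y t) \<le> A"
    and kappa_pos: "\<kappa> > 0"
    and q_range: "0 < q" "q \<le> 1"
    and d: "\<And>x y t' t''. x \<in> D \<Longrightarrow> y \<in> Y \<Longrightarrow> t' \<in> T \<Longrightarrow> t'' \<in> T \<Longrightarrow>
              norm (\<Psi> x y t' - \<Psi> x y t'') \<le> \<kappa> * norm (t' - t'') powr q"
  shows
    "(\<forall>y\<in>Y. \<forall>t\<in>T. \<forall>x\<in>D.
        let \<gamma> = norm (vec_pos_part (\<Psi> x y t));
            xhat = (1 - \<gamma> / (\<gamma> + \<alpha>)) *\<^sub>R x + (\<gamma> / (\<gamma> + \<alpha>)) *\<^sub>R xbar y t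
        in xhat \<in> X y t \<and>
           norm (x - xhat) \<le> norm (x - xbar y t) / \<alpha> * norm (vec_pos_part (\<Psi> x y t)) \<and>
           infdist x (X y t) \<le> diameter (X y t) / \<alpha> * norm (vec_pos_part (\<Psi> x y t))) \<and>
     (\<forall>y\<in>Y. hausdorff_uniformly_continuous_on T (X y) \<and>
        (\<forall>t'\<in>T. \<forall>t''\<in>T.
           hausdorff_distance (X y t') (X y t'') \<le> A * \<kappa> / \<alpha> * norm (t' - t'') powr q)) \<and>
     (\<forall>y\<in>Y. \<exists>\<upsilon>. continuous_on T \<upsilon> \<and> \<upsilon> ` T \<subseteq> D \<and>
        (\<forall>i. \<forall>t\<in>T. \<psi> i (\<upsilon> t) y t \<le> - \<alpha> / 2))"
proof -
  let ?pp = "\<lambda>x y t. norm (vec_pos_part (\<Psi> x y t))"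
  have X_iff: "x \<in> X y t \<longleftrightarrow> x \<in> D \<and> (\<forall>i. \<psi> i x y t \<le> 0)" for x y t
    by (simp add: X_def feasible_set_def)
  have \<Psi>_nth: "\<Psi> x y t $ i = \<psi> i x y t" for x y t i
    by (simp add: \<Psi>_def constraint_vec_def)
  have repair: "(1 - ?pp x y t / (?pp x y t + \<alpha>)) *\<^sub>R x + (?pp x y t / (?pp x y t + \<alpha>)) *\<^sub>R xbar y t \<in> X y t"
    if "y \<in> Y" "t \<in> T" "x \<in> D" for x y t
  proof -
    have "xbar y t \<in> D" "\<And>i. \<psi> i (xbar y t) y t \<le> - \<alpha>"
      using b[OF that(1,2)] by (auto simp: X_iff)
    \<comment> \<open>The norm dominates every single violation, so one weight, and hence one point,
      repairs all constraints at once.\<close>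
    moreover have "\<psi> i x y t \<le> ?pp x y t" for i
      using le_norm_vec_pos_part[of "\<Psi> x y t" i] by (simp add: \<Psi>_nth)
    ultimately show ?thesis
      using slater_segment_feasible[OF a[OF that(1,2)] that(3), where \<gamma> = "?pp x y t"] alpha_pos
      by (auto simp: X_iff)
  qed
  have error_bound: "infdist x (X y t) \<le> diameter (X y t) / \<alpha> * ?pp x y t"
    if "y \<in> Y" "t \<in> T" "x \<in> D" for x y t
    using infdist_le_slater_violation[OF _ _ refl alpha_pos repair[OF that]] b c that by blast
  have one_sided: "infdist x (X y t'') \<le> A * \<kappa> / \<alpha> * norm (t' - t'') powr q"
    if "y \<in> Y" "t' \<in> T" "t'' \<in> T" "x \<in> X y t'" for x y t' t''
  proof -
    have x: "x \<in> D" "\<And>i. \<Psi> x y t' $ i \<le> 0"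
      using that by (auto simp: X_iff \<Psi>_nth)
    \<comment> \<open>Feasibility of \<open>x\<close> at \<open>t'\<close> enters here: its
      violation at \<open>t''\<close> comes only from the change of parameter.\<close>
    have "?pp x y t'' \<le> norm (\<Psi> x y t'' - \<Psi> x y t')"
      using x by (intro norm_vec_pos_part_le_diff)
    also have "\<dots> \<le> \<kappa> * norm (t' - t'') powr q"
      using d[OF x(1) that(1,2,3)] by (simp add: norm_minus_commute)
    finally have "diameter (X y t'') / \<alpha> * ?pp x y t'' \<le> A / \<alpha> * (\<kappa> * norm (t' - t'') powr q)"
      using c[OF that(1,3)] A_pos alpha_pos by (intro mult_mono divide_right_mono) auto
    then show ?thesis
      using error_bound[OF that(1,3) x(1)] by (simp add: mult.assoc)
  qed
  \<comment> \<open>Both halves are the one-sided estimate with the parameters exchanged;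
    \<open>xbar\<close> witnesses nonemptiness.\<close>
  have hausdorff: "hausdorff_distance (X y t') (X y t'') \<le> A * \<kappa> / \<alpha> * norm (t' - t'') powr q"
    if "y \<in> Y" "t' \<in> T" "t'' \<in> T" for y t' t''
    using one_sided[of y t' t''] one_sided[of y t'' t'] b[of y t'] b[of y t''] that
    by (intro hausdorff_distance_leI) (auto simp: norm_minus_commute)
  have uniform: "hausdorff_uniformly_continuous_on T (X y)" if "y \<in> Y" for y
    using hausdorff[OF that] q_range A_pos kappa_pos alpha_pos
    by (intro hausdorff_uniformly_continuous_on_if_hoelder[where C = "A * \<kappa> / \<alpha>" and q = q])
      (auto simp: dist_norm)
  have selection: "\<exists>\<upsilon>. continuous_on T \<upsilon> \<and> \<upsilon> ` T \<subseteq> D \<and> (\<forall>i. \<forall>t\<in>T. \<psi> i (\<upsilon> t) y t \<le> - \<alpha> / 2)"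
    if y: "y \<in> Y" for y
  proof -
    let ?G = "\<lambda>t. {x \<in> D. \<forall>i. \<psi> i x y t \<le> - \<alpha> / 2}"
    \<comment> \<open>Within distance \<delta> a constraint value changes by less than half the
      margin. Thus the fixed point \<open>xbar y t\<close> serves on a whole ball around
      \<open>t\<close>, although \<open>xbar\<close> itself may be discontinuous in
      \<open>t\<close>.\<close>
    obtain \<delta> where "0 < \<delta>" and \<delta>: "\<And>r. 0 \<le> r \<Longrightarrow> r < \<delta> \<Longrightarrow> \<kappa> * r powr q < \<alpha> / 2"
      using powr_bound_eventually_small[of \<kappa> "\<alpha> / 2" q] kappa_pos alpha_pos q_range by auto
    have "xbar y t \<in> ?G t'" if t: "t \<in> T" "t' \<in> T \<inter> ball t \<delta>" for t t'
    proof -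
      have xb: "xbar y t \<in> D" "\<And>i. \<psi> i (xbar y t) y t \<le> - \<alpha>"
        using b[OF y t(1)] by (auto simp: X_iff)
      have "\<psi> i (xbar y t) y t' \<le> - \<alpha> / 2" for i
      proof -
        have "\<psi> i (xbar y t) y t' - \<psi> i (xbar y t) y t \<le> norm (\<Psi> (xbar y t) y t' - \<Psi> (xbar y t) y t)"
          using component_le_norm_cart[of "\<Psi> (xbar y t) y t' - \<Psi> (xbar y t) y t" i]
          by (simp add: \<Psi>_nth)
        also have "\<dots> \<le> \<kappa> * norm (t' - t) powr q"
          using d xb(1) y t by blast
        also have "\<dots> < \<alpha> / 2"
          using t by (intro \<delta>) (auto simp: dist_norm norm_minus_commute)
        finally show ?thesis
          using xb(2)[of i] by linarith
      qed
      then show ?thesis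
        using xb(1) by simp
    qed
    then have "\<exists>U x. open U \<and> t \<in> U \<and> (\<forall>t' \<in> T \<inter> U. x \<in> ?G t')" if "t \<in> T" for t
      using that \<open>0 < \<delta>\<close> by (meson centre_in_ball open_ball)
    moreover have "convex (?G t)" if "t \<in> T" for t
      \<comment> \<open>Convexity of \<open>D\<close> is read off from \<open>convex_on\<close>,
        which includes convexity of the domain.\<close>
      using a[OF y that] by (intro convex_sublevel) (auto dest: convex_on_imp_convex)
    ultimately obtain \<upsilon> where "continuous_on T \<upsilon>" "\<And>t. t \<in> T \<Longrightarrow> \<upsilon> t \<in> ?G t"
      using continuous_selection_of_locally_constant[of T ?G] by blast
    then show ?thesis
      by blast
  qed
  show ?thesis
    unfolding Let_def
  proof (intro conjI ballI)
    fix y t x assume "y \<in> Y" "t \<in> T" "x \<in> D"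
    show "norm (x - ((1 - ?pp x y t / (?pp x y t + \<alpha>)) *\<^sub>R x + (?pp x y t / (?pp x y t + \<alpha>)) *\<^sub>R xbar y t))
        \<le> norm (x - xbar y t) / \<alpha> * ?pp x y t"
      by (rule slater_segment_distance(1)[OF norm_ge_zero alpha_pos])
  qed (use repair error_bound hausdorff uniform selection in blast)+
qed

end
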